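(* For every $\varepsilon>0$ and all sufficiently large $n$ there is an undirected simple graph $G=(V,E)$ on $n$ vertices and an integer $k$ (namely $k=\lfloor\sqrt n\rfloor$) such that the optimum value of the integer program $$\min \sum_{e\in E} y_e \ \text{ s.t. } \sum_{v\in V}x_v\ge k,\quad y_e\ge x_u,\ y_e\ge x_v\ \ \forall e=(u,v)\in E,\quad x_v\in\{0,1\}\ \forall v,\ y_e\in\{0,1\}\ \forall e$$ is at least $(2-\varepsilon)$ times the optimum value of its linear programming relaxation (obtained by replacing the integrality constraints by $x_v\ge 0$, $y_e\ge 0$). That is, this LP has integrality gap $2(1-o(1))$.
   Context: This integer program is the natural formulation of the unweighted Fixed cost minimum edge cover problem: given $G$ and $k$, choose at least $k$ vertices minimizing the number of edges with at least one endpoint among the chosen vertices. *)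

theory Defs
  imports "HOL-Library.Landau_Symbols"
begin

definition simple_graph :: "'v set \<Rightarrow> 'v set set \<Rightarrow> bool" where
  "simple_graph V E \<longleftrightarrow> finite V \<and> (\<forall>e\<in>E. e \<subseteq> V \<and> card e = 2)"

text \<open>Only the values of \<open>x\<close> on \<open>V\<close> and of \<open>y\<close> on \<open>E\<close> matter in what follows.\<close>

definition cover_constraints ::
    "'v set \<Rightarrow> 'v set set \<Rightarrow> int \<Rightarrow> ('v \<Rightarrow> real) \<times> ('v set \<Rightarrow> real) \<Rightarrow> bool" where
  "cover_constraints V E k = (\<lambda>(x, y).
     (\<Sum>v\<in>V. x v) \<ge> of_int k \<and> (\<forall>e\<in>E. \<forall>v\<in>e. y e \<ge> x v))"

definition ip_feasible ::
    "'v set \<Rightarrow> 'v set set \<Rightarrow> int \<Rightarrow> ('v \<Rightarrow> real) \<times> ('v set \<Rightarrow> real) \<Rightarrow> bool" where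
  "ip_feasible V E k = (\<lambda>(x, y). cover_constraints V E k (x, y) \<and>
     (\<forall>v\<in>V. x v \<in> {0, 1}) \<and> (\<forall>e\<in>E. y e \<in> {0, 1}))"

text \<open>The relaxation imposes no upper bounds on the variables.\<close>

definition lp_feasible ::
    "'v set \<Rightarrow> 'v set set \<Rightarrow> int \<Rightarrow> ('v \<Rightarrow> real) \<times> ('v set \<Rightarrow> real) \<Rightarrow> bool" where
  "lp_feasible V E k = (\<lambda>(x, y). cover_constraints V E k (x, y) \<and>
     (\<forall>v\<in>V. x v \<ge> 0) \<and> (\<forall>e\<in>E. y e \<ge> 0))"

definition cover_cost :: "'v set set \<Rightarrow> ('v \<Rightarrow> real) \<times> ('v set \<Rightarrow> real) \<Rightarrow> real" where
  "cover_cost E = (\<lambda>(x, y). \<Sum>e\<in>E. y e)"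

text \<open>Optimum values are attained minima, so an infeasible program has none.\<close>

definition ip_optimum :: "'v set \<Rightarrow> 'v set set \<Rightarrow> int \<Rightarrow> real \<Rightarrow> bool" where
  "ip_optimum V E k m \<longleftrightarrow>
     (\<exists>z. is_arg_min (cover_cost E) (ip_feasible V E k) z \<and> cover_cost E z = m)"

definition lp_optimum :: "'v set \<Rightarrow> 'v set set \<Rightarrow> int \<Rightarrow> real \<Rightarrow> bool" where
  "lp_optimum V E k m \<longleftrightarrow>
     (\<exists>z. is_arg_min (cover_cost E) (lp_feasible V E k) z \<and> cover_cost E z = m)"

text \<open>The integrality gap of a single instance is defined only when the optimum of the
  relaxation is positive.\<close>

definition has_integrality_gap :: "'v set \<Rightarrow> 'v set set \<Rightarrow> int \<Rightarrow> real \<Rightarrow> bool" where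
  "has_integrality_gap V E k r \<longleftrightarrow>
     (\<exists>ip lp. ip_optimum V E k ip \<and> lp_optimum V E k lp \<and> lp > 0 \<and> r = ip / lp)"

end

theory Submission
  imports Defs "HOL-Real_Asymp.Real_Asymp"
begin

text \<open>
  The complete graph \<open>K\<^sub>n\<close> attains the gap. In a \<open>d\<close>-regular graph, bounding
  \<open>y\<^sub>e\<close> below by the average of its two endpoint values shows that the uniform solution
  \<open>x = y = k / n\<close> is optimal for the relaxation, with value \<open>d k / 2\<close>. An integral solution
  pays for every edge meeting the chosen set, and \<open>k\<close> vertices of \<open>K\<^sub>n\<close> meet
  \<open>(n - 1) k - k (k - 1) / 2\<close> edges. The ratio is \<open>2 - (k - 1) / (n - 1)\<close>, which tends to
  \<open>2\<close> because \<open>k = o(n)\<close>.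
\<close>

text \<open>Double counting of incident pairs: exchanging the two sums makes each vertex contribute
  \<open>x v\<close> once for every edge through it. This single identity yields both the edge count
  and the lower bound for the relaxation.\<close>

lemma sum_incident_vertices:
  fixes x :: "'v \<Rightarrow> real"
  assumes G: "simple_graph V E" and deg: "\<And>v. v \<in> V \<Longrightarrow> card {e\<in>E. v \<in> e} = d"
  shows "(\<Sum>e\<in>E. \<Sum>v\<in>e. x v) = real d * (\<Sum>v\<in>V. x v)"
proof -
  have fin: "finite V" "finite E"
    using G unfolding simple_graph_def by (auto intro: finite_subset[of E "Pow V"])
  have "(\<Sum>e\<in>E. \<Sum>v\<in>e. x v) = (\<Sum>e\<in>E. \<Sum>v | v \<in> V \<and> v \<in> e. x v)"
    using G unfolding simple_graph_def by (intro sum.cong refl) auto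
  also have "\<dots> = (\<Sum>v\<in>V. \<Sum>e | e \<in> E \<and> v \<in> e. x v)"
    by (rule sum.swap_restrict[OF fin(2,1)])
  also have "\<dots> = (\<Sum>v\<in>V. real d * x v)"
    using deg by (intro sum.cong refl) simp
  finally show ?thesis by (simp add: sum_distrib_left)
qed

lemma regular_graph_lp_optimum:
  assumes G: "simple_graph V E" and deg: "\<And>v. v \<in> V \<Longrightarrow> card {e\<in>E. v \<in> e} = d"
    and "V \<noteq> {}" and "k \<ge> 0"
  shows "lp_optimum V E k (real d * of_int k / 2)"
proof -
  \<comment> \<open>Nothing caps the variables of the relaxation, so the uniform solution stays
    feasible even when \<open>k\<close> exceeds \<open>card V\<close> and \<open>c\<close> exceeds
    1.\<close>
  define c :: real where "c = of_int k / real (card V)"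
  have cardV: "card V > 0"
    using G \<open>V \<noteq> {}\<close> by (simp add: simple_graph_def card_gt_0_iff)
  have card_e: "card e = 2" if "e \<in> E" for e
    using G that by (simp add: simple_graph_def)
  \<comment> \<open>The incidence identity at \<open>x = 1\<close>, which determines
    \<open>card E\<close> and hence the cost of the uniform solution.\<close>
  have "(\<Sum>e\<in>E. \<Sum>v\<in>e. 1) = real d * (\<Sum>v\<in>V. 1)"
    by (rule sum_incident_vertices[OF G deg])
  then have handshake: "2 * real (card E) = real d * real (card V)"
    using card_e by simp
  have cost: "cover_cost E (\<lambda>_. c, \<lambda>_. c) = real d * of_int k / 2"
    using handshake cardV by (simp add: cover_cost_def c_def field_simps)
  have feasible: "lp_feasible V E k (\<lambda>_. c, \<lambda>_. c)"
    using cardV \<open>k \<ge> 0\<close> by (simp add: lp_feasible_def cover_constraints_def c_def)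
  have "real d * of_int k / 2 \<le> cover_cost E z" if "lp_feasible V E k z" for z
  proof -
    obtain x y where z: "z = (x, y)" by fastforce
    have k: "of_int k \<le> (\<Sum>v\<in>V. x v)" and y: "\<And>e v. e \<in> E \<Longrightarrow> v \<in> e \<Longrightarrow> x v \<le> y e"
      using that by (auto simp: z lp_feasible_def cover_constraints_def)
    have "real d * of_int k \<le> real d * (\<Sum>v\<in>V. x v)"
      using k by (rule mult_left_mono) simp
    also have "\<dots> = (\<Sum>e\<in>E. \<Sum>v\<in>e. x v)"
      by (rule sum_incident_vertices[OF G deg, symmetric])
    \<comment> \<open>Both constraints of each edge are added up; as every edge has two endpoints,
      \<open>y e\<close> is then counted twice.\<close>
    also have "\<dots> \<le> (\<Sum>e\<in>E. \<Sum>v\<in>e. y e)"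
      using y by (intro sum_mono)
    also have "\<dots> = 2 * cover_cost E z"
      using card_e by (simp add: z cover_cost_def sum_distrib_left)
    finally show ?thesis by simp
  qed
  then show ?thesis
    unfolding lp_optimum_def is_arg_min_linorder using cost feasible by metis
qed

definition complete_edges :: "'v set \<Rightarrow> 'v set set" where
  "complete_edges V = {e. e \<subseteq> V \<and> card e = 2}"

lemma simple_graph_complete: "finite V \<Longrightarrow> simple_graph V (complete_edges V)"
  by (simp add: simple_graph_def complete_edges_def)

lemma finite_complete_edges: "finite V \<Longrightarrow> finite (complete_edges V)"
  by (rule finite_subset[of _ "Pow V"]) (auto simp: complete_edges_def)

lemma card_complete_edges: "finite V \<Longrightarrow> card (complete_edges V) = card V choose 2"
  by (simp add: complete_edges_def n_subsets)

lemma card_complete_edges_at: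
  assumes "finite V" and v: "v \<in> V"
  shows "card {e \<in> complete_edges V. v \<in> e} = card V - 1"
proof -
  have "{e \<in> complete_edges V. v \<in> e} = (\<lambda>u. {v, u}) ` (V - {v})"
    using v by (auto simp: complete_edges_def card_2_iff)
  moreover have "inj_on (\<lambda>u. {v, u}) (V - {v})"
    by (auto simp: inj_on_def doubleton_eq_iff)
  ultimately show ?thesis
    using assms by (simp add: card_image)
qed

text \<open>The edges that avoid \<open>S\<close> form the complete graph on \<open>V - S\<close>,
  so the count depends on \<open>S\<close> only through its size. This is why no choice of vertices
  in a complete graph beats another of equal size.\<close>

lemma card_complete_edges_meeting:
  assumes "finite V" and "S \<subseteq> V"
  shows "real (card {e \<in> complete_edges V. e \<inter> S \<noteq> {}}) =
    real (card V choose 2) - real ((card V - card S) choose 2)"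
proof -
  have "{e \<in> complete_edges V. e \<inter> S \<noteq> {}} = complete_edges V - complete_edges (V - S)"
    by (auto simp: complete_edges_def)
  moreover have "complete_edges (V - S) \<subseteq> complete_edges V"
    by (auto simp: complete_edges_def)
  ultimately have "real (card {e \<in> complete_edges V. e \<inter> S \<noteq> {}}) =
      real (card (complete_edges V)) - real (card (complete_edges (V - S)))"
    using assms(1) by (simp add: card_Diff_subset finite_complete_edges card_mono of_nat_diff)
  moreover have "card (V - S) = card V - card S"
    using assms by (simp add: card_Diff_subset finite_subset)
  ultimately show ?thesis
    using assms(1) by (simp add: card_complete_edges)
qed

lemma complete_graph_ip_optimum:
  assumes fin: "finite V" and k: "k \<le> card V"
  shows "ip_optimum V (complete_edges V) (int k)
    (real (card V choose 2) - real ((card V - k) choose 2))"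
    (is "ip_optimum V ?E _ ?m")
proof -
  obtain S where S: "S \<subseteq> V" "card S = k"
    using obtain_subset_with_card_n[OF k] by metis
  define x :: "'a \<Rightarrow> real" where "x v = of_bool (v \<in> S)" for v
  \<comment> \<open>The least edge vector compatible with \<open>x\<close>: an edge is paid for
    exactly when it meets \<open>S\<close>.\<close>
  define y :: "'a set \<Rightarrow> real" where "y e = of_bool (e \<inter> S \<noteq> {})" for e
  have "(\<Sum>v\<in>V. x v) = real k"
    using fin S by (simp add: x_def Int_absorb1)
  then have feasible: "ip_feasible V ?E (int k) (x, y)"
    by (auto simp: ip_feasible_def cover_constraints_def x_def y_def)
  have "cover_cost ?E (x, y) = real (card {e \<in> ?E. e \<inter> S \<noteq> {}})"
    using finite_complete_edges[OF fin] by (simp add: cover_cost_def y_def Int_def)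
  then have cost: "cover_cost ?E (x, y) = ?m"
    using card_complete_edges_meeting[OF fin S(1)] S(2) by simp
  have "?m \<le> cover_cost ?E z" if "ip_feasible V ?E (int k) z" for z
  proof -
    obtain x y where z: "z = (x, y)" by fastforce
    have sum: "real k \<le> (\<Sum>v\<in>V. x v)"
      and xy: "\<And>e v. e \<in> ?E \<Longrightarrow> v \<in> e \<Longrightarrow> x v \<le> y e"
      and x: "\<And>v. v \<in> V \<Longrightarrow> x v \<in> {0, 1}" and y: "\<And>e. e \<in> ?E \<Longrightarrow> y e \<in> {0, 1}"
      using that by (auto simp: z ip_feasible_def cover_constraints_def)
    define T where "T = {v\<in>V. x v = 1}"
    have "(\<Sum>v\<in>V. x v) = (\<Sum>v\<in>V. of_bool (v \<in> T))"
      using x by (intro sum.cong) (auto simp: T_def)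
    also have "\<dots> = real (card T)"
      using fin by (simp add: T_def Int_def)
    finally have "k \<le> card T"
      using sum by simp
    \<comment> \<open>A feasible solution may choose more than \<open>k\<close> vertices; the edges
      left untouched then can only become fewer, since the binomial coefficient is monotone in its
      upper argument.\<close>
    then have "?m \<le> real (card V choose 2) - real ((card V - card T) choose 2)"
      by (simp add: binomial_right_mono)
    also have "\<dots> = real (card {e \<in> ?E. e \<inter> T \<noteq> {}})"
      by (rule card_complete_edges_meeting[OF fin, symmetric]) (simp add: T_def)
    also have "\<dots> = (\<Sum>e\<in>?E. of_bool (e \<inter> T \<noteq> {}))"
      using finite_complete_edges[OF fin] by (simp add: Int_def)
    \<comment> \<open>An edge meeting \<open>T\<close> has an endpoint of value 1, which forces
      \<open>y e\<close> up to 1; on the other edges nonnegativity suffices.\<close>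
    also have "\<dots> \<le> (\<Sum>e\<in>?E. y e)"
    proof (rule sum_mono)
      fix e assume e: "e \<in> ?E"
      show "of_bool (e \<inter> T \<noteq> {}) \<le> y e"
      proof (cases "e \<inter> T = {}")
        case False
        then obtain v where "v \<in> e" "x v = 1" by (auto simp: T_def)
        then show ?thesis using xy[OF e] by (simp add: False) force
      qed (use y[OF e] in auto)
    qed
    finally show ?thesis by (simp add: z cover_cost_def)
  qed
  then show ?thesis
    unfolding ip_optimum_def is_arg_min_linorder using cost feasible by metis
qed

text \<open>Subtraction over the reals, free of truncation, turns the gap into a rational function;
  at \<open>n = 0\<close> both sides vanish.\<close>

lemma real_choose_two: "real (n choose 2) = real n * (real n - 1) / 2"
  by (cases n) (simp_all add: choose_two real_of_nat_div algebra_simps)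

lemma complete_graph_integrality_gap:
  assumes fin: "finite V" and n: "card V \<ge> 2" and k: "0 < k" "k \<le> card V"
  shows "has_integrality_gap V (complete_edges V) (int k)
    (2 * (1 - (real k - 1) / (2 * (real (card V) - 1))))"
proof -
  define n where "n = card V"
  define ip where "ip = real (n choose 2) - real ((n - k) choose 2)"
  define lp where "lp = real (n - 1) * of_int (int k) / 2"
  have "ip_optimum V (complete_edges V) (int k) ip"
    unfolding ip_def n_def by (rule complete_graph_ip_optimum[OF fin k(2)])
  moreover have "lp_optimum V (complete_edges V) (int k) lp"
    unfolding lp_def n_def
    by (rule regular_graph_lp_optimum)
      (use fin n in \<open>auto simp: simple_graph_complete card_complete_edges_at\<close>)
  moreover have "lp > 0"
    using n k by (simp add: lp_def n_def)
  moreover have "2 * (1 - (real k - 1) / (2 * (real n - 1))) = ip / lp"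
  proof -
    have "real n - 1 > 0" "real k > 0" "real (n - k) = real n - real k"
      "real (n - 1) = real n - 1"
      using n k by (auto simp: n_def of_nat_diff)
    \<comment> \<open>Here \<open>ip\<close> is k(2n - k - 1)/2 and \<open>lp\<close> is k(n - 1)/2,
      so the quotient is (2n - k - 1)/(n - 1).\<close>
    then show ?thesis
      unfolding ip_def lp_def real_choose_two by (simp add: divide_simps) (simp add: algebra_simps)
  qed
  ultimately show ?thesis
    unfolding has_integrality_gap_def n_def by blast
qed

theorem theorem4p1:
  "(\<forall>\<epsilon>::real. \<epsilon> > 0 \<longrightarrow>
      (\<forall>\<^sub>F n::nat in sequentially.
         \<exists>(V::nat set) (E::nat set set) (k::int) (ip::real) (lp::real).
           simple_graph V E \<and> card V = n \<and> k = \<lfloor>sqrt (real n)\<rfloor> \<and>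
           ip_optimum V E k ip \<and> lp_optimum V E k lp \<and> lp > 0 \<and>
           ip \<ge> (2 - \<epsilon>) * lp))
   \<and> (\<exists>(V::nat \<Rightarrow> nat set) (E::nat \<Rightarrow> nat set set) (\<delta>::nat \<Rightarrow> real).
        \<delta> \<in> o(\<lambda>_. 1) \<and>
        (\<forall>\<^sub>F n in sequentially.
           simple_graph (V n) (E n) \<and> card (V n) = n \<and>
           has_integrality_gap (V n) (E n) \<lfloor>sqrt (real n)\<rfloor> (2 * (1 - \<delta> n))))"
proof -
  \<comment> \<open>The relative loss from the complete graph gap at k = floor(sqrt n); it decays
    like 1/(2 sqrt n).\<close>
  define \<delta> :: "nat \<Rightarrow> real"
    where "\<delta> n = (of_int \<lfloor>sqrt (real n)\<rfloor> - 1) / (2 * (real n - 1))" for n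
  have lim: "\<delta> \<longlonglongrightarrow> 0"
    unfolding \<delta>_def by real_asymp
  have gap: "has_integrality_gap {..<n} (complete_edges {..<n}) \<lfloor>sqrt (real n)\<rfloor> (2 * (1 - \<delta> n))"
    if "n \<ge> 2" for n
  proof -
    define k where "k = nat \<lfloor>sqrt (real n)\<rfloor>"
    have k: "\<lfloor>sqrt (real n)\<rfloor> = int k"
      by (simp add: k_def)
    have "1 \<le> sqrt (real n)"
      using that by simp
    then have "0 < k"
      by (simp add: k_def)
    have "sqrt (real n) \<le> real n"
      using that by (intro real_le_lsqrt) (simp_all add: power2_eq_square)
    then have "k \<le> n"
      unfolding k_def by linarith
    then show ?thesis
      using complete_graph_integrality_gap[of "{..<n}" k] that \<open>0 < k\<close> by (simp add: k \<delta>_def)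
  qed
  have "\<forall>\<^sub>F n in sequentially. \<exists>(V::nat set) E k ip lp.
      simple_graph V E \<and> card V = n \<and> k = \<lfloor>sqrt (real n)\<rfloor> \<and>
      ip_optimum V E k ip \<and> lp_optimum V E k lp \<and> lp > 0 \<and> ip \<ge> (2 - \<epsilon>) * lp"
    if "\<epsilon> > 0" for \<epsilon> :: real
  proof -
    \<comment> \<open>The threshold is half of \<epsilon> because the gap 2(1 - \<delta> n) loses
      twice \<delta> n.\<close>
    have "\<forall>\<^sub>F n in sequentially. \<delta> n < \<epsilon> / 2"
      using lim that by (intro order_tendstoD(2)) auto
    then show ?thesis
      using eventually_ge_at_top[of 2]
    proof eventually_elim
      case (elim n)
      obtain ip lp where opt: "ip_optimum {..<n} (complete_edges {..<n}) \<lfloor>sqrt (real n)\<rfloor> ip"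
          "lp_optimum {..<n} (complete_edges {..<n}) \<lfloor>sqrt (real n)\<rfloor> lp" "lp > 0"
        and ratio: "2 * (1 - \<delta> n) = ip / lp"
        using gap[OF elim(2)] unfolding has_integrality_gap_def by blast
      have "2 - \<epsilon> \<le> ip / lp"
        unfolding ratio[symmetric] using elim(1) by (simp add: field_simps)
      then have "(2 - \<epsilon>) * lp \<le> ip"
        using \<open>lp > 0\<close> by (simp add: pos_le_divide_eq)
      then show ?case
        using opt simple_graph_complete[of "{..<n}"] by (metis card_lessThan finite_lessThan)
    qed
  qed
  moreover have "\<delta> \<in> o(\<lambda>_. 1)"
    using lim by (intro smalloI_tendsto) simp_all
  moreover have "\<forall>\<^sub>F n in sequentially. simple_graph {..<n} (complete_edges {..<n}) \<and>
      card {..<n} = n \<and>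
      has_integrality_gap {..<n} (complete_edges {..<n}) \<lfloor>sqrt (real n)\<rfloor> (2 * (1 - \<delta> n))"
    using eventually_ge_at_top[of 2]
    by eventually_elim (intro conjI gap simple_graph_complete; simp)
  ultimately show ?thesis
    by (intro conjI allI impI exI[of _ "\<lambda>n. {..<n}"] exI[of _ "\<lambda>n. complete_edges {..<n}"]
        exI[of _ \<delta>])
qed

end
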